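(* Let $U$ be an interval containing $[a,b]$ (with $a<b$ finite), let $\phi$ be continuous and of bounded variation on $[a,b]$, and let $\mathcal{F}=\{F_\mu:\mu\in U\}$ be a Type I location-shift family. Set $$K_1(t,x)=\frac{t}{2\pi}\int_a^b\phi(y)\,dy\int_{[-1,1]}\frac{\cos\{ts(x-y)\}}{r_0(ts)}\,ds .$$ Then $$\psi_1(t,\mu):=\int K_1(t,x)\,dF_\mu(x)=\mathcal{D}_\phi(t,\mu;a,b),$$ and the pair $$K(t,x)=K_1(t,x)-2^{-1}\{\phi(a)K_{1,0}(t,x;a)+\phi(b)K_{1,0}(t,x;b)\},$$ $$\psi(t,\mu)=\psi_1(t,\mu)-2^{-1}\{\phi(a)\psi_{1,0}(t,\mu;a)+\phi(b)\psi_{1,0}(t,\mu;b)\}$$ is as desired for estimating $\check\pi_{0,m}=m^{-1}\sum_{\{i\le m:\mu_i\in(a,b)\}}\phi(\mu_i)$; that is, for every $\mu\in U$, $\psi(t,\mu)=\int K(t,x)\,dF_\mu(x)$ and $\lim_{t\to\infty}\psi(t,\mu)=1_{(a,b)}(\mu)\phi(\mu)$.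
   Context: $\mathcal{F}=\{F_\mu:\mu\in U\}$ is a family of CDFs on $\mathbb{R}$, each $F_\mu$ being uniquely determined by $\mu$ (its mean or median). $\mathcal{F}$ is a location-shift family if $z+\mu'$ has CDF $F_{\mu+\mu'}$ whenever $z$ has CDF $F_\mu$ and $\mu,\mu+\mu'\in U$. Let $\iota=\sqrt{-1}$, $\hat F_\mu(t)=\int e^{\iota tx}dF_\mu(x)$ and $r_\mu(t)=|\hat F_\mu(t)|$. $\mathcal{F}$ is a Type I location-shift family if it is a location-shift family for which $\hat F_0$ has no real zeros and $\hat F_0=r_0$ (so $0\in U$ is implicit). For $\phi\in L^1([a,b])$, $$\mathcal{D}_\phi(t,\mu;a,b)=\frac1\pi\int_a^b\frac{\sin\{(\mu-y)t\}}{\mu-y}\phi(y)\,dy,\qquad t,\mu\in\mathbb{R}.$$ $\omega$ is an even, bounded probability density function on $[-1,1]$ of bounded variation. For $\mu'\in U$, $$K_{1,0}(t,x;\mu')=\int_{[-1,1]}\frac{\omega(s)\cos\{ts(x-\mu')\}}{r_{\mu'}(ts)}ds,\qquad \psi_{1,0}(t,\mu;\mu')=\int K_{1,0}(t,x;\mu')\,dF_\mu(x)$$ (the latter equals $\int_{[-1,1]}\omega(s)\cos\{ts(\mu-\mu')\}ds$). The product $1_{(a,b)}(\mu)\phi(\mu)$ is $0$ for $\mu\notin(a,b)$. An integral $\int dy\int g\,ds$ denotes the iterated integral $\int(\int g\,ds)\,dy$. *)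

theory Defs
  imports "HOL-Probability.Probability"
begin

definition bounded_variation_on :: "(real \<Rightarrow> real) \<Rightarrow> real \<Rightarrow> real \<Rightarrow> bool" where
  "bounded_variation_on f a b \<longleftrightarrow>
     (\<exists>C. \<forall>(n::nat) (x::nat \<Rightarrow> real).
        (\<forall>i\<le>n. x i \<in> {a..b}) \<and> (\<forall>i<n. x i \<le> x (Suc i)) \<longrightarrow>
        (\<Sum>i<n. \<bar>f (x (Suc i)) - f (x i)\<bar>) \<le> C)"

definition is_cdf :: "(real \<Rightarrow> real) \<Rightarrow> bool" where
  "is_cdf G \<longleftrightarrow> mono G \<and> (\<forall>x. continuous (at_right x) G) \<and>
     (G \<longlongrightarrow> 0) at_bot \<and> (G \<longlongrightarrow> 1) at_top"

text \<open>Integrals against \<open>dG\<close> are integrals with respect to the measure \<open>interval_measure G\<close>.\<close>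

definition is_mean :: "(real \<Rightarrow> real) \<Rightarrow> real \<Rightarrow> bool" where
  "is_mean G \<mu> \<longleftrightarrow> integrable (interval_measure G) (\<lambda>x. x) \<and>
     (LINT x|interval_measure G. x) = \<mu>"

definition is_median :: "(real \<Rightarrow> real) \<Rightarrow> real \<Rightarrow> bool" where
  "is_median G \<mu> \<longleftrightarrow> measure (interval_measure G) {..\<mu>} \<ge> 1/2 \<and>
     measure (interval_measure G) {\<mu>..} \<ge> 1/2"

text \<open>That each \<open>F \<mu>\<close> is uniquely determined by \<open>\<mu>\<close> is expressed by \<open>F\<close> being a function
  of \<open>\<mu>\<close>; its values outside \<open>U\<close> are irrelevant.\<close>

definition cdf_family :: "real set \<Rightarrow> (real \<Rightarrow> real \<Rightarrow> real) \<Rightarrow> bool" where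
  "cdf_family U F \<longleftrightarrow> (\<forall>\<mu>\<in>U. is_cdf (F \<mu>)) \<and>
     ((\<forall>\<mu>\<in>U. is_mean (F \<mu>) \<mu>) \<or> (\<forall>\<mu>\<in>U. is_median (F \<mu>) \<mu>))"

definition has_cdf :: "'w measure \<Rightarrow> ('w \<Rightarrow> real) \<Rightarrow> (real \<Rightarrow> real) \<Rightarrow> bool" where
  "has_cdf M z G \<longleftrightarrow> prob_space M \<and> z \<in> borel_measurable M \<and> cdf (distr M borel z) = G"

text \<open>Sample spaces over the type \<^typ>\<open>real\<close> suffice: every law on the line is that of the
  identity on some probability space over the reals.\<close>

definition location_shift_family :: "real set \<Rightarrow> (real \<Rightarrow> real \<Rightarrow> real) \<Rightarrow> bool" where
  "location_shift_family U F \<longleftrightarrow> cdf_family U F \<and>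
     (\<forall>\<mu> \<mu>'. \<mu> \<in> U \<longrightarrow> \<mu> + \<mu>' \<in> U \<longrightarrow>
        (\<forall>(M :: real measure) z. has_cdf M z (F \<mu>) \<longrightarrow>
           has_cdf M (\<lambda>w. z w + \<mu>') (F (\<mu> + \<mu>'))))"

definition Fhat :: "(real \<Rightarrow> real \<Rightarrow> real) \<Rightarrow> real \<Rightarrow> real \<Rightarrow> complex" where
  "Fhat F \<mu> t = char (interval_measure (F \<mu>)) t"

definition modulus :: "(real \<Rightarrow> real \<Rightarrow> real) \<Rightarrow> real \<Rightarrow> real \<Rightarrow> real" where
  "modulus F \<mu> t = cmod (Fhat F \<mu> t)"

definition type_I_family :: "real set \<Rightarrow> (real \<Rightarrow> real \<Rightarrow> real) \<Rightarrow> bool" where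
  "type_I_family U F \<longleftrightarrow> location_shift_family U F \<and> 0 \<in> U \<and>
     (\<forall>t. Fhat F 0 t \<noteq> 0) \<and> (\<forall>t. Fhat F 0 t = complex_of_real (modulus F 0 t))"

text \<open>The integrand below is \<open>0\<close> at \<open>y = \<mu>\<close> (division by zero) rather than its continuous
  extension \<open>t * \<phi> \<mu>\<close>; this concerns a null set only.\<close>

definition dirichlet_integral ::
  "(real \<Rightarrow> real) \<Rightarrow> real \<Rightarrow> real \<Rightarrow> real \<Rightarrow> real \<Rightarrow> real" where
  "dirichlet_integral \<phi> a b t \<mu> =
     1 / pi * (LINT y:{a..b}|lborel. sin ((\<mu> - y) * t) / (\<mu> - y) * \<phi> y)"

text \<open>An even, bounded density on \<open>[-1, 1]\<close> of bounded variation; the values of \<open>\<omega>\<close>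
  outside this interval play no role.\<close>

definition admissible_density :: "(real \<Rightarrow> real) \<Rightarrow> bool" where
  "admissible_density \<omega> \<longleftrightarrow>
     set_borel_measurable lborel {-1..1} \<omega> \<and> (\<forall>s\<in>{-1..1}. 0 \<le> \<omega> s) \<and>
     (LINT s:{-1..1}|lborel. \<omega> s) = 1 \<and>
     (\<forall>s\<in>{-1..1}. \<omega> (- s) = \<omega> s) \<and> bounded (\<omega> ` {-1..1}) \<and>
     bounded_variation_on \<omega> (-1) 1"

definition K10 :: "(real \<Rightarrow> real \<Rightarrow> real) \<Rightarrow> (real \<Rightarrow> real) \<Rightarrow> real \<Rightarrow> real \<Rightarrow> real \<Rightarrow> real" where
  "K10 F \<omega> \<mu>' t x =
     (LINT s:{-1..1}|lborel. \<omega> s * cos (t * s * (x - \<mu>')) / modulus F \<mu>' (t * s))"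

definition psi10 :: "(real \<Rightarrow> real \<Rightarrow> real) \<Rightarrow> (real \<Rightarrow> real) \<Rightarrow> real \<Rightarrow> real \<Rightarrow> real \<Rightarrow> real" where
  "psi10 F \<omega> \<mu>' t \<mu> = (LINT x|interval_measure (F \<mu>). K10 F \<omega> \<mu>' t x)"

definition K1 ::
  "(real \<Rightarrow> real \<Rightarrow> real) \<Rightarrow> (real \<Rightarrow> real) \<Rightarrow> real \<Rightarrow> real \<Rightarrow> real \<Rightarrow> real \<Rightarrow> real" where
  "K1 F \<phi> a b t x = t / (2 * pi) *
     (LINT y:{a..b}|lborel. \<phi> y *
        (LINT s:{-1..1}|lborel. cos (t * s * (x - y)) / modulus F 0 (t * s)))"

definition psi1 ::
  "(real \<Rightarrow> real \<Rightarrow> real) \<Rightarrow> (real \<Rightarrow> real) \<Rightarrow> real \<Rightarrow> real \<Rightarrow> real \<Rightarrow> real \<Rightarrow> real" where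
  "psi1 F \<phi> a b t \<mu> = (LINT x|interval_measure (F \<mu>). K1 F \<phi> a b t x)"

definition kernel_K ::
  "(real \<Rightarrow> real \<Rightarrow> real) \<Rightarrow> (real \<Rightarrow> real) \<Rightarrow> (real \<Rightarrow> real) \<Rightarrow> real \<Rightarrow> real \<Rightarrow> real \<Rightarrow> real \<Rightarrow> real"
where
  "kernel_K F \<omega> \<phi> a b t x =
     K1 F \<phi> a b t x - 1/2 * (\<phi> a * K10 F \<omega> a t x + \<phi> b * K10 F \<omega> b t x)"

definition psi ::
  "(real \<Rightarrow> real \<Rightarrow> real) \<Rightarrow> (real \<Rightarrow> real) \<Rightarrow> (real \<Rightarrow> real) \<Rightarrow> real \<Rightarrow> real \<Rightarrow> real \<Rightarrow> real \<Rightarrow> real"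
where
  "psi F \<omega> \<phi> a b t \<mu> =
     psi1 F \<phi> a b t \<mu> - 1/2 * (\<phi> a * psi10 F \<omega> a t \<mu> + \<phi> b * psi10 F \<omega> b t \<mu>)"

end

theory Submission
  imports Defs
begin

text \<open>
  Two facts carry the theorem: an exact deconvolution identity and a pointwise convergence theorem
  for Dirichlet integrals.

  \<^emph>\<open>Deconvolution.\<close> In a Type I location-shift family the law with parameter \<open>\<mu>\<close> has
  characteristic function \<open>exp (\<i> u \<mu>) r\<^sub>0(u)\<close> with \<open>r\<^sub>0\<close> continuous and strictly positive
  (\<open>type_I_family_facts\<close>). Hence \<open>cos (t s (x - y)) / r\<^sub>0(t s)\<close> has expectation
  \<open>cos (t s (\<mu> - y))\<close>. All integrands are bounded, because \<open>r\<^sub>0\<close> is bounded below on compact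
  intervals, so Fubini's theorem allows this to be integrated over \<open>s\<close> and \<open>y\<close>
  (\<open>deconvolution_kernel_expectation\<close>). Since the integral of \<open>t cos (t s v)\<close> over
  \<open>s \<in> [-1, 1]\<close> is \<open>2 sin (t v) / v\<close>, the expectation of \<open>K1\<close> is the Dirichlet integral
  (\<open>K1_expectation\<close>), and the expectation of \<open>K10\<close> is a cosine integral of \<open>\<omega>\<close>
  (\<open>K10_expectation\<close>).

  \<^emph>\<open>Limits.\<close> By the Dirichlet-Jordan theorem (\<open>dirichlet_jordan\<close>) the Dirichlet integral tends
  to \<open>\<phi>(\<mu>)\<close> for \<open>\<mu>\<close> inside \<open>(a, b)\<close>, to \<open>\<phi>(\<mu>) / 2\<close> at the two end points and to \<open>0\<close> outside
  \<open>[a, b]\<close>. The correction terms remove the end-point values: the cosine integral of the density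
  \<open>\<omega>\<close> equals \<open>1\<close> at \<open>\<mu> = \<mu>'\<close> and otherwise tends to \<open>0\<close> (\<open>psi10_tendsto\<close>).

  Both limits are reduced to monotone functions by the Jordan decomposition. The second mean value
  theorem then bounds the integral of a monotone function against an oscillating kernel by
  increments of the primitive of the kernel. These are uniformly small away from the point at which
  the kernel concentrates (\<open>mono_kernel_uniform_limit\<close>); near that point they are bounded, and the
  monotone function is close to its one-sided limit (\<open>mono_kernel_limit_at_left_end\<close>). For the Dirichlet kernel that
  primitive is the sine integral \<open>Si\<close>, which is bounded and tends to \<open>\<pi> / 2\<close>.
\<close>

section \<open>Functions of bounded variation\<close>

text \<open>The Jordan decomposition: \<open>g x\<close> is taken to be the variation of \<open>f\<close> on \<open>[a, x]\<close>, and
  \<open>h = g - f\<close>.\<close>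

lemma jordan_decomposition:
  fixes f :: "real \<Rightarrow> real"
  assumes "bounded_variation_on f a b" "a \<le> b"
  obtains g h where "mono_on {a..b} g" "mono_on {a..b} h" "\<And>x. x \<in> {a..b} \<Longrightarrow> f x = g x - h x"
proof -
  define chain where "chain x n p \<longleftrightarrow> (\<forall>i\<le>n. p i \<in> {a..x}) \<and> (\<forall>i<n. p i \<le> p (Suc i))"
    for x and n :: nat and p :: "nat \<Rightarrow> real"
  define var where "var n p = (\<Sum>i<n. \<bar>f (p (Suc i)) - f (p i)\<bar>)" for n :: nat and p
  define W where "W x = {var n p | n p. chain x n p}" for x
  define V where "V x = Sup (W x)" for x
  obtain C where C: "\<And>n p. chain b n p \<Longrightarrow> var n p \<le> C"
    using assms(1) unfolding bounded_variation_on_def chain_def var_def by metis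
  have chain_mono: "chain y n p" if "chain x n p" "x \<le> y" for x y n p
    using that unfolding chain_def by fastforce
  have bdd: "bdd_above (W x)" if "x \<in> {a..b}" for x
    unfolding W_def bdd_above_def using that chain_mono[of x _ _ b] C by auto blast
  have ne: "W x \<noteq> {}" if "x \<in> {a..b}" for x
  proof -
    have "chain x 0 (\<lambda>_. a)" using that by (auto simp: chain_def)
    then show ?thesis by (auto simp: W_def)
  qed
  have key: "V x + \<bar>f y - f x\<bar> \<le> V y" if "a \<le> x" "x \<le> y" "y \<le> b" for x y
  proof -
    have "V x \<le> V y - \<bar>f y - f x\<bar>"
      unfolding V_def[of x]
    proof (rule cSup_least[OF ne])
      show "x \<in> {a..b}" using that by auto
      fix s assume "s \<in> W x"
      then obtain n p where s: "s = var n p" and c: "chain x n p" by (auto simp: W_def)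
      \<comment> \<open>The chain is prolonged by the two points \<open>x\<close> and \<open>y\<close>.\<close>
      define q where "q i = (if i \<le> n then p i else if i = Suc n then x else y)" for i
      have "chain y (Suc (Suc n)) q"
        unfolding chain_def
      proof (intro conjI allI impI)
        fix i show "q i \<in> {a..y}"
          using c that by (force simp: q_def chain_def)
      next
        fix i assume i: "i < Suc (Suc n)"
        then consider "i < n" | "i = n" | "i = Suc n" by linarith
        then show "q i \<le> q (Suc i)"
          using c that by cases (auto simp: q_def chain_def)
      qed
      then have "var (Suc (Suc n)) q \<in> W y" by (auto simp: W_def)
      then have "var (Suc (Suc n)) q \<le> V y"
        unfolding V_def using that by (intro cSup_upper bdd) auto
      moreover have "(\<Sum>i<n. \<bar>f (q (Suc i)) - f (q i)\<bar>) = var n p"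
        unfolding var_def by (intro sum.cong) (auto simp: q_def)
      then have "var (Suc (Suc n)) q = s + \<bar>f x - f (p n)\<bar> + \<bar>f y - f x\<bar>"
        unfolding s by (simp add: var_def[of "Suc (Suc n)"] q_def)
      ultimately show "s \<le> V y - \<bar>f y - f x\<bar>" by linarith
    qed
    then show ?thesis by linarith
  qed
  show thesis
  proof (rule that)
    show "mono_on {a..b} V"
      by (intro mono_onI) (use key in fastforce)
    show "mono_on {a..b} (\<lambda>x. V x - f x)"
      by (intro mono_onI) (use key in fastforce)
  qed auto
qed

section \<open>Monotone functions against oscillating kernels\<close>

lemma mono_on_mult_integrable:
  fixes g k :: "real \<Rightarrow> real"
  assumes "mono_on {a..b} g" "k integrable_on {a..b}" "a \<le> b"
  shows "(\<lambda>y. g y * k y) integrable_on {a..b}"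
  by (rule second_mean_value_theorem_full[OF assms(2,3), of g])
     (use assms(1) in \<open>auto simp: mono_on_def integrable_on_def\<close>)

text \<open>Here \<open>S t\<close> is a primitive of the kernel \<open>k t\<close>. If \<open>S t\<close> is uniformly close to a constant on
  \<open>[a, b]\<close>, then all partial integrals of \<open>k t\<close> are small, and the second mean value theorem
  transfers this to the integral weighted by \<open>g\<close>. The hypothesis on \<open>k\<close> is required for large \<open>t\<close>
  only, since the primitive \<open>sin (t s c) / (t c)\<close> of \<open>cos (t s c)\<close> needs \<open>t \<noteq> 0\<close>.\<close>

lemma mono_kernel_uniform_limit:
  fixes g :: "real \<Rightarrow> real" and k S :: "real \<Rightarrow> real \<Rightarrow> real"
  assumes "mono_on {a..b} g" "a \<le> b"
    and k: "\<forall>\<^sub>F t in at_top. \<forall>c d. a \<le> c \<longrightarrow> c \<le> d \<longrightarrow> d \<le> b \<longrightarrow>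
              (k t has_integral S t d - S t c) {c..d}"
    and lim: "uniform_limit {a..b} S (\<lambda>_. s) at_top"
  shows "((\<lambda>t. integral {a..b} (\<lambda>y. g y * k t y)) \<longlongrightarrow> 0) at_top"
proof (rule tendstoI)
  fix e :: real assume "e > 0"
  define M where "M = 2 * (\<bar>g a\<bar> + \<bar>g b\<bar>) + 1"
  have "M > 0" using abs_ge_zero[of "g a"] abs_ge_zero[of "g b"] by (simp add: M_def)
  with \<open>e > 0\<close> have "e / M > 0" by simp
  from k uniform_limitD[OF lim this]
  show "\<forall>\<^sub>F t in at_top. dist (integral {a..b} (\<lambda>y. g y * k t y)) 0 < e"
  proof eventually_elim
    case (elim t)
    have "k t integrable_on {a..b}" using elim(1) \<open>a \<le> b\<close> by blast
    then obtain c where c: "c \<in> {a..b}"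
      and eq: "integral {a..b} (\<lambda>y. g y * k t y) = g a * integral {a..c} (k t) + g b * integral {c..b} (k t)"
      by (rule second_mean_value_theorem[of _ _ _ g]) (use assms(1,2) in \<open>auto simp: mono_on_def\<close>)
    have near: "\<bar>S t x - s\<bar> < e / M" if "x \<in> {a..b}" for x
      using elim(2) that by (auto simp: dist_real_def)
    have "integral {a..c} (k t) = S t c - S t a" "integral {c..b} (k t) = S t b - S t c"
      using elim(1) c by (auto intro!: integral_unique)
    moreover have "\<bar>S t c - S t a\<bar> \<le> 2 * (e / M)" "\<bar>S t b - S t c\<bar> \<le> 2 * (e / M)"
      using near[of c] near[of a] near[of b] c \<open>a \<le> b\<close> unfolding abs_if by (auto split: if_splits)
    ultimately have "\<bar>integral {a..b} (\<lambda>y. g y * k t y)\<bar> \<le> \<bar>g a\<bar> * (2 * (e / M)) + \<bar>g b\<bar> * (2 * (e / M))"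
      unfolding eq by (intro order_trans[OF abs_triangle_ineq] add_mono) (simp_all only: abs_mult mult_left_mono abs_ge_zero)
    also have "\<dots> = (M - 1) * (e / M)" by (simp add: M_def algebra_simps add_divide_distrib)
    also have "\<dots> < e" using \<open>M > 0\<close> \<open>e > 0\<close> by (simp add: field_simps)
    finally show ?case by simp
  qed
qed

text \<open>The kernel now concentrates at \<open>a\<close>: its primitive, normalised to vanish at \<open>a\<close>, is bounded and
  tends to \<open>s\<close> uniformly away from \<open>a\<close>. Near \<open>a\<close> the second mean value theorem gives a bound by
  the small increment of \<open>g\<close>, uniformly in \<open>t\<close>; away from \<open>a\<close> the preceding lemma applies.\<close>

lemma mono_kernel_limit_at_left_end:
  fixes g :: "real \<Rightarrow> real" and k S :: "real \<Rightarrow> real \<Rightarrow> real"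
  assumes mono: "mono_on {a..b} g" and "a < b"
    and k: "\<And>t c d. a \<le> c \<Longrightarrow> c \<le> d \<Longrightarrow> d \<le> b \<Longrightarrow> (k t has_integral S t d - S t c) {c..d}"
    and S0: "\<And>t. S t a = 0" and bound: "\<And>t x. \<bar>S t x\<bar> \<le> B"
    and lim: "\<And>c. a < c \<Longrightarrow> uniform_limit {c..b} S (\<lambda>_. s) at_top"
    and p: "(g \<longlongrightarrow> p) (at_right a)"
  shows "((\<lambda>t. integral {a..b} (\<lambda>y. g y * k t y)) \<longlongrightarrow> p * s) at_top"
proof -
  \<comment> \<open>Subtracting the one-sided limit makes \<open>g\<close> vanish continuously at the end point.\<close>
  define h where "h y = (if y \<le> a then 0 else g y - p)" for y
  have ge: "p \<le> g y" if "a < y" "y \<le> b" for y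
  proof (rule tendsto_upperbound[OF p])
    show "\<forall>\<^sub>F x in at_right a. g x \<le> g y"
      unfolding eventually_at_right_field using that mono by (intro exI[of _ y]) (auto simp: mono_on_def)
  qed simp
  have hmono: "mono_on {a..b} h"
    by (intro mono_onI) (use ge mono in \<open>auto simp: h_def mono_on_def\<close>)
  have hk: "(\<lambda>y. h y * k t y) integrable_on {c..d}" if "a \<le> c" "c \<le> d" "d \<le> b" for t c d
    using hmono that k by (intro mono_on_mult_integrable has_integral_integrable[OF k]) (auto simp: mono_on_def)
  have split: "integral {a..b} (\<lambda>y. g y * k t y) = p * S t b + integral {a..b} (\<lambda>y. h y * k t y)" for t
  proof -
    have "((\<lambda>y. p * k t y + h y * k t y) has_integral
            p * (S t b - S t a) + integral {a..b} (\<lambda>y. h y * k t y)) {a..b}"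
      using \<open>a < b\<close> by (intro has_integral_add has_integral_mult_right k integrable_integral hk) auto
    then have "((\<lambda>y. g y * k t y) has_integral
            p * (S t b - S t a) + integral {a..b} (\<lambda>y. h y * k t y)) {a..b}"
      by (rule has_integral_spike_finite[of "{a}", rotated 2]) (auto simp: h_def algebra_simps)
    then show ?thesis by (simp add: integral_unique S0)
  qed
  have "((\<lambda>t. integral {a..b} (\<lambda>y. h y * k t y)) \<longlongrightarrow> 0) at_top"
  proof (rule tendstoI)
    fix e :: real assume "e > 0"
    have "B \<ge> 0" using bound[of 0 0] by linarith
    have "((\<lambda>y. g y - p) \<longlongrightarrow> p - p) (at_right a)" by (intro tendsto_intros p)
    then have "\<forall>\<^sub>F y in at_right a. dist (g y - p) 0 < e / (4 * B + 1)"
      using \<open>e > 0\<close> \<open>B \<ge> 0\<close> by (intro tendstoD) auto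
    then have "\<forall>\<^sub>F y in at_right a. dist (g y - p) 0 < e / (4 * B + 1) \<and> a < y \<and> y < b"
      using \<open>a < b\<close> by (intro eventually_conj eventually_at_right_less)
        (auto simp: eventually_at_right_field)
    then obtain c where c: "a < c" "c < b" and gc: "\<bar>g c - p\<bar> < e / (4 * B + 1)"
      using eventually_happens[of _ "at_right a"] by (auto simp: dist_real_def)
    have "((\<lambda>t. integral {c..b} (\<lambda>y. h y * k t y)) \<longlongrightarrow> 0) at_top"
    proof (rule mono_kernel_uniform_limit[OF _ _ _ lim])
      show "mono_on {c..b} h" using hmono c by (auto simp: mono_on_def)
    qed (use c k in auto)
    then have "\<forall>\<^sub>F t in at_top. dist (integral {c..b} (\<lambda>y. h y * k t y)) 0 < e / 2"
      using \<open>e > 0\<close> by (intro tendstoD) auto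
    then show "\<forall>\<^sub>F t in at_top. dist (integral {a..b} (\<lambda>y. h y * k t y)) 0 < e"
    proof eventually_elim
      case (elim t)
      have "k t integrable_on {a..c}" using k c by (meson less_imp_le order_refl integrable_on_def)
      then obtain z where z: "z \<in> {a..c}"
        and eq: "integral {a..c} (\<lambda>y. h y * k t y) = h a * integral {a..z} (k t) + h c * integral {z..c} (k t)"
        by (rule second_mean_value_theorem[of _ _ _ h]) (use hmono c in \<open>auto simp: mono_on_def\<close>)
      have "integral {z..c} (k t) = S t c - S t z"
        using z c by (intro integral_unique k) auto
      then have "\<bar>integral {a..c} (\<lambda>y. h y * k t y)\<bar> = \<bar>g c - p\<bar> * \<bar>S t c - S t z\<bar>"
        unfolding eq using c by (simp add: h_def abs_mult)
      also have "\<dots> \<le> e / (4 * B + 1) * (2 * B)"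
        using gc bound[of t c] bound[of t z] \<open>e > 0\<close> \<open>B \<ge> 0\<close>
        by (intro mult_mono) auto
      also have "\<dots> \<le> e / 2" using \<open>e > 0\<close> \<open>B \<ge> 0\<close> by (simp add: field_simps)
      finally have "\<bar>integral {a..c} (\<lambda>y. h y * k t y)\<bar> \<le> e / 2" .
      moreover have "integral {a..b} (\<lambda>y. h y * k t y) =
          integral {a..c} (\<lambda>y. h y * k t y) + integral {c..b} (\<lambda>y. h y * k t y)"
        using c by (intro Henstock_Kurzweil_Integration.integral_combine[symmetric] hk) auto
      ultimately show ?case using elim by (simp add: dist_real_def)
    qed
  qed
  moreover have "((\<lambda>t. S t b) \<longlongrightarrow> s) at_top"
    using lim[OF \<open>a < b\<close>] by (rule tendsto_uniform_limitI) simp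
  ultimately have "((\<lambda>t. p * S t b + integral {a..b} (\<lambda>y. h y * k t y)) \<longlongrightarrow> p * s + 0) at_top"
    by (intro tendsto_intros)
  then show ?thesis by (simp add: split)
qed

section \<open>The Dirichlet kernel\<close>

text \<open>The kernel \<open>sin (t v) / v\<close>, extended continuously to \<open>v = 0\<close>.\<close>

definition dirichlet_kernel :: "real \<Rightarrow> real \<Rightarrow> real" where
  "dirichlet_kernel t v = t * sinc (t * v)"

lemma dirichlet_kernel_nonzero: "v \<noteq> 0 \<Longrightarrow> dirichlet_kernel t v = sin (v * t) / v"
  by (auto simp: dirichlet_kernel_def mult.commute)

lemma dirichlet_kernel_minus: "dirichlet_kernel t (- v) = dirichlet_kernel t v"
  by (auto simp: dirichlet_kernel_def)

lemma continuous_on_dirichlet_kernel [continuous_intros]: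
  "continuous_on S f \<Longrightarrow> continuous_on S (\<lambda>x. dirichlet_kernel t (f x))"
  unfolding dirichlet_kernel_def by (intro continuous_intros)

lemma dirichlet_kernel_has_integral:
  assumes "c \<le> d"
  shows "((\<lambda>y. dirichlet_kernel t (y - \<mu>)) has_integral Si (t * (d - \<mu>)) - Si (t * (c - \<mu>))) {c..d}"
proof (rule fundamental_theorem_of_calculus[OF assms])
  fix y
  have "((\<lambda>y. Si (t * (y - \<mu>))) has_real_derivative sinc (t * (y - \<mu>)) * (t * 1)) (at y)"
    by (rule DERIV_chain2[OF DERIV_Si]) (auto intro!: derivative_eq_intros)
  then show "((\<lambda>y. Si (t * (y - \<mu>))) has_vector_derivative dirichlet_kernel t (y - \<mu>)) (at y within {c..d})"
    by (simp add: dirichlet_kernel_def has_real_derivative_iff_has_vector_derivative mult.commute has_vector_derivative_at_within)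
qed

lemma Si_0: "Si 0 = 0"
  by (simp add: Si_def flip: zero_ereal_def)

lemma Si_minus: "Si (- x) = - Si x"
  using Si_neg[of x] Si_neg[of "- x"] by (cases "0 \<le> x") auto

lemma Si_uniform_limit:
  assumes "\<mu> < c"
  shows "uniform_limit {c..d} (\<lambda>t y. Si (t * (y - \<mu>))) (\<lambda>_. pi / 2) at_top"
proof (rule uniform_limitI)
  fix e :: real assume "e > 0"
  obtain T where T: "\<And>u. T \<le> u \<Longrightarrow> dist (Si u) (pi / 2) < e"
    using tendstoD[OF Si_at_top \<open>e > 0\<close>] by (auto simp: eventually_at_top_linorder)
  show "\<forall>\<^sub>F t in at_top. \<forall>y\<in>{c..d}. dist (Si (t * (y - \<mu>))) (pi / 2) < e"
    using eventually_ge_at_top[of "\<bar>T\<bar> / (c - \<mu>)"]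
  proof eventually_elim
    case (elim t)
    have "0 \<le> \<bar>T\<bar> / (c - \<mu>)" using assms by simp
    then have "t \<ge> 0" using elim by linarith
    have "\<bar>T\<bar> \<le> t * (c - \<mu>)" using elim assms by (simp add: field_simps)
    then show ?case using T mult_left_mono[OF _ \<open>t \<ge> 0\<close>]
      by (smt (verit, best) atLeastAtMost_iff)
  qed
qed

section \<open>The Dirichlet-Jordan theorem\<close>

lemma dirichlet_left_end_limit:
  assumes "mono_on {\<mu>..b} g" "\<mu> < b" and p: "(g \<longlongrightarrow> p) (at_right \<mu>)"
  shows "((\<lambda>t. integral {\<mu>..b} (\<lambda>y. g y * dirichlet_kernel t (y - \<mu>))) \<longlongrightarrow> p * (pi / 2)) at_top"
proof -
  obtain B where "\<And>T. \<bar>Si T\<bar> \<le> B" using bounded_Si by auto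
  then show ?thesis
    by (intro mono_kernel_limit_at_left_end[OF assms(1,2) dirichlet_kernel_has_integral _ _ Si_uniform_limit p])
       (auto simp: Si_0)
qed

lemma dirichlet_right_end_limit:
  assumes "mono_on {a..\<mu>} g" "a < \<mu>" and p: "(g \<longlongrightarrow> p) (at_left \<mu>)"
  shows "((\<lambda>t. integral {a..\<mu>} (\<lambda>y. g y * dirichlet_kernel t (y - \<mu>))) \<longlongrightarrow> p * (pi / 2)) at_top"
proof -
  \<comment> \<open>The reflection \<open>y \<mapsto> - y\<close> exchanges the two ends; the outer sign keeps the function increasing.\<close>
  have "((\<lambda>y. - g (- y)) \<longlongrightarrow> - p) (at_right (- \<mu>))"
    using p by (intro tendsto_minus) (simp add: at_left_minus filterlim_filtermap)
  then have "((\<lambda>t. integral {-\<mu>..-a} (\<lambda>y. (- g (- y)) * dirichlet_kernel t (y - (- \<mu>)))) \<longlongrightarrow> (- p) * (pi / 2)) at_top"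
    using assms by (intro dirichlet_left_end_limit) (auto simp: mono_on_def)
  from tendsto_minus[OF this]
  have *: "((\<lambda>t. integral {-\<mu>..-a} (\<lambda>y. g (- y) * dirichlet_kernel t (y + \<mu>))) \<longlongrightarrow> p * (pi / 2)) at_top"
    by (simp flip: Henstock_Kurzweil_Integration.integral_neg)
  moreover have "integral {-\<mu>..-a} (\<lambda>y. g (- y) * dirichlet_kernel t (y + \<mu>)) =
        integral {a..\<mu>} (\<lambda>y. g y * dirichlet_kernel t (y - \<mu>))" for t
  proof -
    have "dirichlet_kernel t (- y - \<mu>) = dirichlet_kernel t (y + \<mu>)" for y
      using dirichlet_kernel_minus[of t "y + \<mu>"] by simp
    then show ?thesis
      using Henstock_Kurzweil_Integration.integral_reflect_real
        [of \<mu> a "\<lambda>y. g y * dirichlet_kernel t (y - \<mu>)"] by simp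
  qed
  ultimately show ?thesis by simp
qed

lemma dirichlet_outside_limit:
  assumes g: "mono_on {a..b} g" "a \<le> b" and \<mu>: "\<mu> \<notin> {a..b}"
  shows "((\<lambda>t. integral {a..b} (\<lambda>y. g y * dirichlet_kernel t (y - \<mu>))) \<longlongrightarrow> 0) at_top"
proof -
  have "\<exists>s. uniform_limit {a..b} (\<lambda>t y. Si (t * (y - \<mu>))) (\<lambda>_. s) at_top"
  proof (cases "\<mu> < a")
    case True
    then show ?thesis using Si_uniform_limit by blast
  next
    case False
    then have "b < \<mu>" using \<mu> by auto
    have eq: "Si (t * (y - \<mu>)) = - Si (t * (- y - - \<mu>))" for t y
      using Si_minus[of "t * (\<mu> - y)"] by (simp add: algebra_simps)
    have "uniform_limit {- b..- a} (\<lambda>t y. Si (t * (y - - \<mu>))) (\<lambda>_. pi / 2) at_top"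
      using \<open>b < \<mu>\<close> by (intro Si_uniform_limit) auto
    then have "uniform_limit {a..b} (\<lambda>t y. Si (t * (- y - - \<mu>))) (\<lambda>_. pi / 2) at_top"
      by (rule uniform_limit_compose') auto
    then have "uniform_limit {a..b} (\<lambda>t y. Si (t * (y - \<mu>))) (\<lambda>_. - (pi / 2)) at_top"
      unfolding eq by (rule uniform_limit_uminus)
    then show ?thesis by blast
  qed
  then show ?thesis
    by (elim exE mono_kernel_uniform_limit[OF g, rotated])
       (simp add: dirichlet_kernel_has_integral)
qed

lemma mono_on_one_sided_limit:
  fixes g :: "real \<Rightarrow> real"
  assumes g: "mono_on {a..b} g"
  shows "a \<le> \<mu> \<Longrightarrow> \<mu> < b \<Longrightarrow> \<exists>p. (g \<longlongrightarrow> p) (at_right \<mu>)"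
    and "a < \<mu> \<Longrightarrow> \<mu> \<le> b \<Longrightarrow> \<exists>p. (g \<longlongrightarrow> p) (at_left \<mu>)"
proof -
  assume \<mu>: "a \<le> \<mu>" "\<mu> < b"
  show "\<exists>p. (g \<longlongrightarrow> p) (at_right \<mu>)"
  proof (intro exI)
    show "(g \<longlongrightarrow> Inf (g ` {\<mu><..b})) (at_right \<mu>)"
    proof (rule order_tendstoI)
      fix l assume "l < Inf (g ` {\<mu><..b})"
      moreover have "Inf (g ` {\<mu><..b}) \<le> g y" if "y \<in> {\<mu><..b}" for y
        using that g \<mu> by (intro cInf_lower) (auto simp: mono_on_def bdd_below_def intro!: exI[of _ "g \<mu>"])
      ultimately show "\<forall>\<^sub>F y in at_right \<mu>. l < g y"
        unfolding eventually_at_right_field using \<mu>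
        by (intro exI[of _ b]) (auto intro!: less_le_trans[of l "Inf (g ` {\<mu><..b})"])
    next
      fix u assume "Inf (g ` {\<mu><..b}) < u"
      then obtain z where z: "\<mu> < z" "z \<le> b" "g z < u"
        using \<mu> cInf_lessD[of "g ` {\<mu><..b}" u] by auto
      then show "\<forall>\<^sub>F y in at_right \<mu>. g y < u"
        unfolding eventually_at_right_field using \<mu> g
        by (intro exI[of _ z]) (auto simp: mono_on_def intro!: le_less_trans[of _ "g z" u])
    qed
  qed
next
  assume \<mu>: "a < \<mu>" "\<mu> \<le> b"
  show "\<exists>p. (g \<longlongrightarrow> p) (at_left \<mu>)"
  proof (intro exI)
    show "(g \<longlongrightarrow> Sup (g ` {a..<\<mu>})) (at_left \<mu>)"
    proof (rule order_tendstoI)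
      fix u assume "Sup (g ` {a..<\<mu>}) < u"
      moreover have "g y \<le> Sup (g ` {a..<\<mu>})" if "y \<in> {a..<\<mu>}" for y
        using that g \<mu> by (intro cSup_upper) (auto simp: mono_on_def bdd_above_def intro!: exI[of _ "g \<mu>"])
      ultimately show "\<forall>\<^sub>F y in at_left \<mu>. g y < u"
        unfolding eventually_at_left_field using \<mu>
        by (intro exI[of _ a]) (auto intro!: le_less_trans[of _ "Sup (g ` {a..<\<mu>})" u])
    next
      fix l assume "l < Sup (g ` {a..<\<mu>})"
      then obtain z where z: "a \<le> z" "z < \<mu>" "l < g z"
        using \<mu> less_cSupD[of "g ` {a..<\<mu>}" l] by auto
      then show "\<forall>\<^sub>F y in at_left \<mu>. l < g y"
        unfolding eventually_at_left_field using \<mu> g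
        by (intro exI[of _ z]) (auto simp: mono_on_def intro!: less_le_trans[of l "g z"])
    qed
  qed
qed

text \<open>The two indicators count the sides from which \<open>[a, b]\<close> approaches \<open>\<mu>\<close>; each contributes
  \<open>(\<pi> / 2) \<phi>(\<mu>)\<close>. The monotone parts of \<open>\<phi>\<close> need not be known to be continuous: only the
  difference of their one-sided limits at \<open>\<mu>\<close> enters, and it equals \<open>\<phi>(\<mu>)\<close> by continuity of \<open>\<phi>\<close>.\<close>

lemma dirichlet_jordan:
  fixes \<phi> :: "real \<Rightarrow> real"
  assumes "a < b" and cont: "continuous_on {a..b} \<phi>" and bv: "bounded_variation_on \<phi> a b"
  shows "((\<lambda>t. integral {a..b} (\<lambda>y. \<phi> y * dirichlet_kernel t (y - \<mu>))) \<longlongrightarrow>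
           pi / 2 * ((indicator {a..<b} \<mu> + indicator {a<..b} \<mu>) * \<phi> \<mu>)) at_top"
proof -
  define I where "I f c d t = integral {c..d} (\<lambda>y. f y * dirichlet_kernel t (y - \<mu>))" for f c d and t :: real
  obtain g h where gh: "mono_on {a..b} g" "mono_on {a..b} h"
    and \<phi>: "\<And>x. x \<in> {a..b} \<Longrightarrow> \<phi> x = g x - h x"
    using jordan_decomposition[OF bv] \<open>a < b\<close> by (metis less_imp_le)
  have sub: "mono_on {c..d} g" "mono_on {c..d} h" if "a \<le> c" "d \<le> b" for c d
    using gh that by (auto simp: mono_on_def)
  have diff: "I \<phi> c d t = I g c d t - I h c d t" if "a \<le> c" "c \<le> d" "d \<le> b" for c d t
  proof -
    have "I \<phi> c d t = integral {c..d} (\<lambda>y. g y * dirichlet_kernel t (y - \<mu>) - h y * dirichlet_kernel t (y - \<mu>))"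
      unfolding I_def using that by (intro Henstock_Kurzweil_Integration.integral_cong)
        (simp add: \<phi> left_diff_distrib)
    also have "\<dots> = I g c d t - I h c d t"
      unfolding I_def
      using that by (intro Henstock_Kurzweil_Integration.integral_diff mono_on_mult_integrable sub
          integrable_continuous_real continuous_intros) auto
    finally show ?thesis .
  qed
  have right: "((\<lambda>t. I \<phi> \<mu> b t) \<longlongrightarrow> \<phi> \<mu> * (pi / 2)) at_top" if \<mu>: "a \<le> \<mu>" "\<mu> < b"
  proof -
    obtain p q where pq: "(g \<longlongrightarrow> p) (at_right \<mu>)" "(h \<longlongrightarrow> q) (at_right \<mu>)"
      using mono_on_one_sided_limit(1)[OF gh(1) \<mu>] mono_on_one_sided_limit(1)[OF gh(2) \<mu>] by auto
    have "(\<phi> \<longlongrightarrow> \<phi> \<mu>) (at \<mu> within {\<mu>..b})"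
      using cont \<mu> by (meson atLeastatMost_subset_iff atLeastAtMost_iff continuous_on_def continuous_on_subset less_imp_le order_refl)
    then have "(\<phi> \<longlongrightarrow> \<phi> \<mu>) (at_right \<mu>)" using \<mu> by (simp add: at_within_Icc_at_right)
    moreover have "\<forall>\<^sub>F y in at_right \<mu>. g y - h y = \<phi> y"
      unfolding eventually_at_right_field using \<mu> \<phi> by (intro exI[of _ b]) auto
    then have "(\<phi> \<longlongrightarrow> p - q) (at_right \<mu>)"
      using tendsto_diff[OF pq] by (rule tendsto_cong[THEN iffD1])
    ultimately have "p - q = \<phi> \<mu>" by (intro tendsto_unique) auto
    have "((\<lambda>t. I g \<mu> b t - I h \<mu> b t) \<longlongrightarrow> p * (pi / 2) - q * (pi / 2)) at_top"
      unfolding I_def using \<mu> by (intro tendsto_diff dirichlet_left_end_limit sub pq) auto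
    then show ?thesis using \<mu> by (simp add: diff left_diff_distrib diff_divide_distrib flip: \<open>p - q = \<phi> \<mu>\<close>)
  qed
  have left: "((\<lambda>t. I \<phi> a \<mu> t) \<longlongrightarrow> \<phi> \<mu> * (pi / 2)) at_top" if \<mu>: "a < \<mu>" "\<mu> \<le> b"
  proof -
    obtain p q where pq: "(g \<longlongrightarrow> p) (at_left \<mu>)" "(h \<longlongrightarrow> q) (at_left \<mu>)"
      using mono_on_one_sided_limit(2)[OF gh(1) \<mu>] mono_on_one_sided_limit(2)[OF gh(2) \<mu>] by auto
    have "(\<phi> \<longlongrightarrow> \<phi> \<mu>) (at \<mu> within {a..\<mu>})"
      using cont \<mu> by (meson atLeastatMost_subset_iff atLeastAtMost_iff continuous_on_def continuous_on_subset less_imp_le order_refl)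
    then have "(\<phi> \<longlongrightarrow> \<phi> \<mu>) (at_left \<mu>)" using \<mu> by (simp add: at_within_Icc_at_left)
    moreover have "\<forall>\<^sub>F y in at_left \<mu>. g y - h y = \<phi> y"
      unfolding eventually_at_left_field using \<mu> \<phi> by (intro exI[of _ a]) auto
    then have "(\<phi> \<longlongrightarrow> p - q) (at_left \<mu>)"
      using tendsto_diff[OF pq] by (rule tendsto_cong[THEN iffD1])
    ultimately have "p - q = \<phi> \<mu>" by (intro tendsto_unique) auto
    have "((\<lambda>t. I g a \<mu> t - I h a \<mu> t) \<longlongrightarrow> p * (pi / 2) - q * (pi / 2)) at_top"
      unfolding I_def using \<mu> by (intro tendsto_diff dirichlet_right_end_limit sub pq) auto
    then show ?thesis using \<mu> by (simp add: diff left_diff_distrib diff_divide_distrib flip: \<open>p - q = \<phi> \<mu>\<close>)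
  qed
  have "((\<lambda>t. I \<phi> a b t) \<longlongrightarrow> pi / 2 * ((indicator {a..<b} \<mu> + indicator {a<..b} \<mu>) * \<phi> \<mu>)) at_top"
  proof -
    consider "\<mu> \<notin> {a..b}" | "\<mu> = a" | "\<mu> = b" | "a < \<mu>" "\<mu> < b" by fastforce
    then show ?thesis
    proof cases
      case 1
      have "((\<lambda>t. I g a b t - I h a b t) \<longlongrightarrow> 0 - 0) at_top"
        unfolding I_def using \<open>a < b\<close> 1 gh by (intro tendsto_diff dirichlet_outside_limit) auto
      then show ?thesis using \<open>a < b\<close> 1 by (auto simp: diff indicator_def)
    next
      case 2
      then show ?thesis using right \<open>a < b\<close> by (simp add: mult.commute)
    next
      case 3
      then show ?thesis using left \<open>a < b\<close> by (simp add: mult.commute)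
    next
      case 4
      have "I \<phi> a b t = I \<phi> a \<mu> t + I \<phi> \<mu> b t" for t
      proof -
        have "(\<lambda>y. \<phi> y * dirichlet_kernel t (y - \<mu>)) integrable_on {a..b}"
          by (intro integrable_continuous_real continuous_intros cont)
        then show ?thesis unfolding I_def
          using 4 by (intro Henstock_Kurzweil_Integration.integral_combine[symmetric]) auto
      qed
      then show ?thesis using tendsto_add[OF left right] 4 by (simp add: algebra_simps)
    qed
  qed
  then show ?thesis by (simp add: I_def)
qed

text \<open>The Riemann-Lebesgue lemma for a function of bounded variation.\<close>

lemma riemann_lebesgue_bounded_variation:
  assumes "bounded_variation_on f a b" "a \<le> b" "c > 0"
  shows "((\<lambda>t. integral {a..b} (\<lambda>s. f s * cos (t * s * c))) \<longlongrightarrow> 0) at_top"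
proof -
  obtain g h where gh: "mono_on {a..b} g" "mono_on {a..b} h"
    and f: "\<And>x. x \<in> {a..b} \<Longrightarrow> f x = g x - h x"
    using jordan_decomposition[OF assms(1,2)] by metis
  have k: "((\<lambda>s. cos (t * s * c)) has_integral sin (t * z * c) / (t * c) - sin (t * y * c) / (t * c)) {y..z}"
    if "y \<le> z" "t > 0" for t y z
    using that \<open>c > 0\<close>
    by (intro fundamental_theorem_of_calculus)
       (auto simp flip: has_real_derivative_iff_has_vector_derivative intro!: derivative_eq_intros)
  have lim: "uniform_limit {a..b} (\<lambda>t s. sin (t * s * c) / (t * c)) (\<lambda>_. 0) at_top"
  proof (rule uniform_limitI)
    fix e :: real assume "e > 0"
    show "\<forall>\<^sub>F t in at_top. \<forall>s\<in>{a..b}. dist (sin (t * s * c) / (t * c)) 0 < e"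
      using eventually_gt_at_top[of "1 / (e * c)"] eventually_gt_at_top[of 0]
    proof eventually_elim
      case (elim t)
      then have "1 / (t * c) < e" using \<open>e > 0\<close> \<open>c > 0\<close> by (simp add: field_simps)
      moreover have "\<bar>sin (t * s * c) / (t * c)\<bar> \<le> 1 / (t * c)" for s
        using elim \<open>c > 0\<close> by (simp add: abs_mult divide_right_mono)
      ultimately show ?case by (auto simp: dist_real_def intro: le_less_trans)
    qed
  qed
  have lim0: "((\<lambda>t. integral {a..b} (\<lambda>s. u s * cos (t * s * c))) \<longlongrightarrow> 0) at_top" if "mono_on {a..b} u" for u
    by (rule mono_kernel_uniform_limit[OF that assms(2) _ lim])
       (use eventually_gt_at_top[of 0] in eventually_elim, simp add: k)
  have int: "(\<lambda>s. u s * cos (t * s * c)) integrable_on {a..b}" if "mono_on {a..b} u" for u t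
    using that assms(2) by (intro mono_on_mult_integrable integrable_continuous_real continuous_intros)
  have "integral {a..b} (\<lambda>s. f s * cos (t * s * c)) =
      integral {a..b} (\<lambda>s. g s * cos (t * s * c)) - integral {a..b} (\<lambda>s. h s * cos (t * s * c))" for t
  proof -
    have "integral {a..b} (\<lambda>s. f s * cos (t * s * c)) =
        integral {a..b} (\<lambda>s. g s * cos (t * s * c) - h s * cos (t * s * c))"
      by (intro Henstock_Kurzweil_Integration.integral_cong) (simp add: f left_diff_distrib)
    also have "\<dots> = integral {a..b} (\<lambda>s. g s * cos (t * s * c)) - integral {a..b} (\<lambda>s. h s * cos (t * s * c))"
      by (intro Henstock_Kurzweil_Integration.integral_diff int gh)
    finally show ?thesis .
  qed
  then show ?thesis using tendsto_diff[OF lim0[OF gh(1)] lim0[OF gh(2)]] by simp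
qed

section \<open>Deconvolution kernels\<close>

lemma Fubini_bounded_interval:
  fixes f :: "real \<Rightarrow> real \<Rightarrow> real"
  assumes P: "real_distribution P" and "c \<le> d"
    and f [measurable]: "(\<lambda>(x, y). indicator {c..d} y * f x y) \<in> borel_measurable (borel \<Otimes>\<^sub>M borel)"
    and bound: "\<And>x y. y \<in> {c..d} \<Longrightarrow> \<bar>f x y\<bar> \<le> B"
  shows "integrable P (\<lambda>x. LINT y:{c..d}|lborel. f x y)"
    and "(LINT x|P. (LINT y:{c..d}|lborel. f x y)) = (LINT y:{c..d}|lborel. (LINT x|P. f x y))"
    and "\<bar>LINT y:{c..d}|lborel. f x y\<bar> \<le> B * (d - c)"
proof -
  interpret P: real_distribution P by fact
  interpret pair_sigma_finite P lborel ..
  define h where "h x y = indicator {c..d} y * f x y" for x y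
  have h [measurable]: "(\<lambda>(x, y). h x y) \<in> borel_measurable (borel \<Otimes>\<^sub>M borel)"
    using f by (simp add: h_def)
  have hb: "\<bar>h x y\<bar> \<le> indicator {c..d} y * B" for x y
    using bound by (auto simp: h_def indicator_def)
  have int_B: "integrable lborel (\<lambda>y. indicator {c..d} y * B)"
    by (intro integrable_mult_left integrable_real_indicator) (auto simp: assms)
  have int_h: "integrable lborel (h x)" for x
    by (rule Bochner_Integration.integrable_bound[OF int_B])
       (use hb in \<open>auto intro!: AE_I2 order_trans[OF _ abs_ge_self]\<close>)
  have norm_h: "(LINT y|lborel. \<bar>h x y\<bar>) \<le> B * (d - c)" for x
  proof -
    have "(LINT y|lborel. \<bar>h x y\<bar>) \<le> (LINT y|lborel. indicator {c..d} y * B)"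
      by (intro integral_mono integrable_abs int_h int_B hb)
    then show ?thesis using \<open>c \<le> d\<close> by (simp add: mult.commute)
  qed
  have int: "integrable (P \<Otimes>\<^sub>M lborel) (\<lambda>(x, y). h x y)"
  proof (rule Fubini_integrable)
    show "integrable P (\<lambda>x. LINT y|lborel. norm (case (x, y) of (x, y) \<Rightarrow> h x y))"
      by (rule P.integrable_const_bound[of _ "B * (d - c)"]) (use norm_h in auto)
  qed (use int_h in auto)
  have eq: "(LINT y:{c..d}|lborel. f x y) = (LINT y|lborel. h x y)" for x
    by (simp add: set_lebesgue_integral_def h_def)
  show "integrable P (\<lambda>x. LINT y:{c..d}|lborel. f x y)"
    unfolding eq using integrable_fst'[OF int] by simp
  have "(LINT x|P. (LINT y:{c..d}|lborel. f x y)) = (LINT y|lborel. (LINT x|P. h x y))"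
    unfolding eq by (rule Fubini_integral[OF int, symmetric])
  then show "(LINT x|P. (LINT y:{c..d}|lborel. f x y)) = (LINT y:{c..d}|lborel. (LINT x|P. f x y))"
    by (simp add: set_lebesgue_integral_def h_def)
  show "\<bar>LINT y:{c..d}|lborel. f x y\<bar> \<le> B * (d - c)"
    unfolding eq using norm_h[of x] integral_abs_bound[of lborel "h x"] by linarith
qed

lemma (in real_distribution) expectation_cos:
  "(LINT x|M. cos (u * (x - y))) = Re (iexp (- (u * y)) * char M u)"
proof -
  have "(LINT x|M. cos (u * (x - y))) = (LINT x|M. Re (iexp (- (u * y)) * iexp (u * x)))"
    by (intro Bochner_Integration.integral_cong) (auto simp: Re_exp algebra_simps simp flip: exp_add)
  also have "\<dots> = Re (CLINT x|M. iexp (- (u * y)) * iexp (u * x))"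
    by (intro integral_Re integrable_mult_right integrable_iexp) auto
  also have "\<dots> = Re (iexp (- (u * y)) * char M u)"
    by (simp add: char_def)
  finally show ?thesis .
qed

text \<open>Averaged over \<open>x\<close> with a law whose characteristic function is \<open>exp (\<i> u \<mu>) r(u)\<close>, the kernel at
  \<open>z = x - y\<close> gives back the cosine integral of the weight \<open>w\<close> at \<open>\<mu> - y\<close>. Both \<open>K10\<close> (weight
  \<open>\<omega>\<close>) and the inner integral of \<open>K1\<close> (weight \<open>1\<close>) are of this form.\<close>

definition deconvolution_kernel :: "(real \<Rightarrow> real) \<Rightarrow> (real \<Rightarrow> real) \<Rightarrow> real \<Rightarrow> real \<Rightarrow> real" where
  "deconvolution_kernel r w t z = (LINT s:{-1..1}|lborel. w s * cos (t * s * z) / r (t * s))"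

context
  fixes P :: "real measure" and r w :: "real \<Rightarrow> real" and t C :: real
  assumes P: "real_distribution P"
    and r_cont: "continuous_on UNIV r" and r_pos: "\<And>u. 0 < r u"
    and w_meas: "set_borel_measurable lborel {-1..1} w"
    and w_bound: "\<And>s. s \<in> {-1..1} \<Longrightarrow> \<bar>w s\<bar> \<le> C"
begin

interpretation P: real_distribution P by (rule P)

lemma deconvolution_integrand_measurable:
  "(\<lambda>(x, s). indicator {-1..1} s * (w s * cos (t * s * (x - y)) / r (t * s)))
     \<in> borel_measurable (borel \<Otimes>\<^sub>M borel)"
proof -
  have [measurable]: "(\<lambda>s. indicator {-1..1} s * w s) \<in> borel_measurable borel"
    using w_meas by (simp add: set_borel_measurable_def)
  have [measurable]: "r \<in> borel_measurable borel"
    by (intro borel_measurable_continuous_onI r_cont)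
  have "(\<lambda>(x, s). indicator {-1..1} s * (w s * cos (t * s * (x - y)) / r (t * s))) =
        (\<lambda>(x, s). (indicator {-1..1} s * w s) * cos (t * s * (x - y)) / r (t * s))"
    by (auto simp: fun_eq_iff)
  also have "\<dots> \<in> borel_measurable (borel \<Otimes>\<^sub>M borel)" by measurable
  finally show ?thesis .
qed

lemma deconvolution_integrand_bounded:
  obtains B where "\<And>s z. s \<in> {-1..1} \<Longrightarrow> \<bar>w s * cos (t * s * z) / r (t * s)\<bar> \<le> B"
proof -
  \<comment> \<open>On the compact range of \<open>t * s\<close> the positive function \<open>r\<close> attains a positive minimum.\<close>
  have "continuous_on {-1..1} (\<lambda>s. r (t * s))"
    by (intro continuous_on_compose2[OF r_cont] continuous_intros) auto
  then obtain m where m: "m \<in> {-1..1}" "\<And>s. s \<in> {-1..1} \<Longrightarrow> r (t * m) \<le> r (t * s)"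
    using continuous_attains_inf[of "{-1..1::real}" "\<lambda>s. r (t * s)"] by auto
  have "\<bar>w s * cos (t * s * z) / r (t * s)\<bar> \<le> C / r (t * m)" if s: "s \<in> {-1..1}" for s z
  proof -
    have "\<bar>w s\<bar> * \<bar>cos (t * s * z)\<bar> \<le> C * 1"
      using w_bound[OF s] by (intro mult_mono) auto
    then have "\<bar>w s\<bar> * \<bar>cos (t * s * z)\<bar> / r (t * s) \<le> C / r (t * m)"
      using m(2)[OF s] r_pos[of "t * m"] r_pos[of "t * s"] w_bound[OF s]
      by (intro frac_le) auto
    then show ?thesis using r_pos[of "t * s"] by (simp add: abs_mult)
  qed
  then show thesis by (rule that)
qed

lemma deconvolution_kernel_integrable:
  "integrable P (\<lambda>x. deconvolution_kernel r w t (x - y))"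
proof -
  obtain B where B: "\<And>s z. s \<in> {-1..1} \<Longrightarrow> \<bar>w s * cos (t * s * z) / r (t * s)\<bar> \<le> B"
    using deconvolution_integrand_bounded by blast
  show ?thesis
    unfolding deconvolution_kernel_def
    by (rule Fubini_bounded_interval(1)[OF P _ deconvolution_integrand_measurable B]) auto
qed

lemma deconvolution_kernel_bounded:
  obtains B where "\<And>z. \<bar>deconvolution_kernel r w t z\<bar> \<le> B"
proof -
  obtain B where B: "\<And>s z. s \<in> {-1..1} \<Longrightarrow> \<bar>w s * cos (t * s * z) / r (t * s)\<bar> \<le> B"
    using deconvolution_integrand_bounded by blast
  have "\<bar>deconvolution_kernel r w t z\<bar> \<le> B * (1 - (-1))" for z
    unfolding deconvolution_kernel_def
    using Fubini_bounded_interval(3)[OF P _ deconvolution_integrand_measurable[of 0] B] by simp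
  then show thesis by (rule that)
qed

lemma deconvolution_kernel_measurable [measurable]:
  "deconvolution_kernel r w t \<in> borel_measurable borel"
  using lborel.borel_measurable_lebesgue_integral[of "\<lambda>z s. indicator {-1..1} s * (w s * cos (t * s * (z - 0)) / r (t * s))" borel]
    deconvolution_integrand_measurable[of 0]
  unfolding deconvolution_kernel_def[abs_def] set_lebesgue_integral_def by simp

lemma deconvolution_kernel_expectation:
  assumes ch: "\<And>u. char P u = iexp (u * \<mu>) * of_real (r u)"
  shows "(LINT x|P. deconvolution_kernel r w t (x - y)) =
         (LINT s:{-1..1}|lborel. w s * cos (t * s * (\<mu> - y)))"
proof -
  obtain B where B: "\<And>s z. s \<in> {-1..1} \<Longrightarrow> \<bar>w s * cos (t * s * z) / r (t * s)\<bar> \<le> B"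
    using deconvolution_integrand_bounded by blast
  have "(LINT x|P. deconvolution_kernel r w t (x - y)) =
      (LINT s:{-1..1}|lborel. (LINT x|P. w s * cos (t * s * (x - y)) / r (t * s)))"
    unfolding deconvolution_kernel_def
    by (rule Fubini_bounded_interval(2)[OF P _ deconvolution_integrand_measurable B]) auto
  also have "\<dots> = (LINT s:{-1..1}|lborel. w s * cos (t * s * (\<mu> - y)))"
  proof (rule set_lebesgue_integral_cong)
    have "(LINT x|P. w s * cos (t * s * (x - y)) / r (t * s)) = w s * cos (t * s * (\<mu> - y))" for s
    proof -
      have "(LINT x|P. cos (t * s * (x - y))) = Re (iexp (- (t * s * y)) * (iexp (t * s * \<mu>) * of_real (r (t * s))))"
        unfolding P.expectation_cos ch ..
      also have "\<dots> = cos (t * s * (\<mu> - y)) * r (t * s)"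
        by (simp add: Re_exp Im_exp right_diff_distrib cos_diff distrib_left distrib_right mult_ac)
      finally show ?thesis using r_pos[of "t * s"] by simp
    qed
    then show "\<forall>s. s \<in> {-1..1} \<longrightarrow> (LINT x|P. w s * cos (t * s * (x - y)) / r (t * s)) = w s * cos (t * s * (\<mu> - y))"
      by blast
  qed auto
  finally show ?thesis .
qed

end

section \<open>Type I location-shift families\<close>

lemma interval_measure_cdf:
  assumes "is_cdf G"
  shows "real_distribution (interval_measure G)" "cdf (interval_measure G) = G"
  using assms unfolding is_cdf_def
  by (auto intro!: real_distribution_interval_measure cdf_interval_measure dest: monoD)

text \<open>The shift property is applied to the identity on the law with parameter \<open>\<mu>\<close>.\<close>

lemma location_shift_char:
  assumes "location_shift_family U F" "\<mu> \<in> U" "\<mu> + \<delta> \<in> U"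
  shows "char (interval_measure (F (\<mu> + \<delta>))) t = iexp (t * \<delta>) * char (interval_measure (F \<mu>)) t"
proof -
  let ?M = "interval_measure (F \<mu>)" and ?N = "interval_measure (F (\<mu> + \<delta>))"
  have cdfs: "is_cdf (F \<mu>)" "is_cdf (F (\<mu> + \<delta>))"
    using assms by (auto simp: location_shift_family_def cdf_family_def)
  interpret M: real_distribution ?M by (rule interval_measure_cdf[OF cdfs(1)])
  have "has_cdf ?M (\<lambda>x. x) (F \<mu>)"
    unfolding has_cdf_def using interval_measure_cdf[OF cdfs(1)] M.prob_space_axioms
    by (auto simp: distr_id2)
  then have "has_cdf ?M (\<lambda>x. x + \<delta>) (F (\<mu> + \<delta>))"
    using assms by (auto simp: location_shift_family_def)
  then have "distr ?M borel (\<lambda>x. x + \<delta>) = ?N"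
    using interval_measure_cdf[OF cdfs(2)]
    by (intro cdf_unique M.real_distribution_distr) (auto simp: has_cdf_def)
  then have "char ?N t = (CLINT x|?M. iexp (t * (x + \<delta>)))"
    unfolding char_def by (subst \<open>_ = ?N\<close>[symmetric], subst integral_distr) auto
  also have "\<dots> = (CLINT x|?M. iexp (t * \<delta>) * iexp (t * x))"
    by (intro Bochner_Integration.integral_cong) (auto simp: algebra_simps simp flip: exp_add)
  also have "\<dots> = iexp (t * \<delta>) * char ?M t" by (simp add: char_def)
  finally show ?thesis .
qed

lemma type_I_family_facts:
  assumes "type_I_family U F" "\<mu> \<in> U"
  shows "real_distribution (interval_measure (F \<mu>))"
    and "char (interval_measure (F \<mu>)) t = iexp (t * \<mu>) * of_real (modulus F 0 t)"
    and "modulus F \<mu> = modulus F 0"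
    and "0 < modulus F 0 t"
    and "continuous_on UNIV (modulus F 0)"
proof -
  have F: "location_shift_family U F" "0 \<in> U" and nz: "\<And>t. Fhat F 0 t \<noteq> 0"
    and real: "\<And>t. Fhat F 0 t = of_real (modulus F 0 t)"
    using assms by (auto simp: type_I_family_def)
  have rd: "real_distribution (interval_measure (F \<nu>))" if "\<nu> \<in> U" for \<nu>
    using F that by (intro interval_measure_cdf) (auto simp: location_shift_family_def cdf_family_def)
  show "real_distribution (interval_measure (F \<mu>))" using rd assms by blast
  show ch: "char (interval_measure (F \<mu>)) t = iexp (t * \<mu>) * of_real (modulus F 0 t)" for t
    using location_shift_char[OF F(1,2), of \<mu> t] assms real[of t] by (simp add: Fhat_def)
  show "0 < modulus F 0 t" using nz by (simp add: modulus_def)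
  show "modulus F \<mu> = modulus F 0"
    unfolding modulus_def[of F \<mu>] Fhat_def ch by (auto simp: norm_mult modulus_def)
  interpret M: real_distribution "interval_measure (F 0)" using rd F by blast
  show "continuous_on UNIV (modulus F 0)"
    unfolding modulus_def[abs_def] Fhat_def
    by (intro continuous_on_norm continuous_at_imp_continuous_on ballI M.isCont_char)
qed

section \<open>Expectations of the kernels and their limits\<close>

lemma LINT_cos_dirichlet_kernel:
  "t * (LINT s:{-1..1}|lborel. cos (t * s * v)) = 2 * dirichlet_kernel t v"
proof (cases "t * v = 0")
  case True
  then show ?thesis by (auto simp: dirichlet_kernel_def set_lebesgue_integral_def)
next
  case False
  have "(LINT s:{-1..1}|lborel. cos (t * s * v)) = integral {-1..1} (\<lambda>s. cos (t * s * v))"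
    by (intro set_borel_integral_eq_integral borel_integrable_atLeastAtMost' continuous_intros)
  also have "((\<lambda>s. cos (t * s * v)) has_integral sin (t * 1 * v) / (t * v) - sin (t * - 1 * v) / (t * v)) {-1..1}"
    using False by (intro fundamental_theorem_of_calculus)
      (auto simp flip: has_real_derivative_iff_has_vector_derivative intro!: derivative_eq_intros)
  then have "integral {-1..1} (\<lambda>s. cos (t * s * v)) = 2 * sin (t * v) / (t * v)"
    by (simp add: integral_unique)
  finally show ?thesis using False by (simp add: dirichlet_kernel_def)
qed

lemma dirichlet_integral_eq_LINT:
  assumes "continuous_on {a..b} \<phi>"
  shows "dirichlet_integral \<phi> a b t \<mu> = 1 / pi * (LINT y:{a..b}|lborel. \<phi> y * dirichlet_kernel t (y - \<mu>))"
proof -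
  have eq: "sin ((\<mu> - y) * t) / (\<mu> - y) * \<phi> y = \<phi> y * dirichlet_kernel t (y - \<mu>)" if "y \<noteq> \<mu>" for y
    using dirichlet_kernel_minus[of t "y - \<mu>"] dirichlet_kernel_nonzero[of "\<mu> - y" t] that by simp
  have cont: "continuous_on {a..b} (\<lambda>y. \<phi> y * dirichlet_kernel t (y - \<mu>))"
    by (intro continuous_intros assms)
  have "(LINT y:{a..b}|lborel. sin ((\<mu> - y) * t) / (\<mu> - y) * \<phi> y) =
        (LINT y:{a..b}|lborel. \<phi> y * dirichlet_kernel t (y - \<mu>))"
    unfolding set_lebesgue_integral_def
    \<comment> \<open>The integrands differ at \<open>y = \<mu>\<close> only, where the left one is \<open>0\<close> and the right one \<open>t * \<phi> \<mu>\<close>.\<close>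
  proof (rule integral_cong_AE)
    have [measurable]: "(\<lambda>y. indicator {a..b} y * \<phi> y) \<in> borel_measurable borel"
      using borel_measurable_continuous_on_indicator[OF _ assms] by simp
    have "(\<lambda>y. indicator {a..b} y *\<^sub>R (sin ((\<mu> - y) * t) / (\<mu> - y) * \<phi> y)) =
          (\<lambda>y. sin ((\<mu> - y) * t) / (\<mu> - y) * (indicator {a..b} y * \<phi> y))"
      by (auto simp: fun_eq_iff)
    also have "\<dots> \<in> borel_measurable lborel" by measurable
    finally show "(\<lambda>y. indicator {a..b} y *\<^sub>R (sin ((\<mu> - y) * t) / (\<mu> - y) * \<phi> y)) \<in> borel_measurable lborel" .
    show "(\<lambda>y. indicator {a..b} y *\<^sub>R (\<phi> y * dirichlet_kernel t (y - \<mu>))) \<in> borel_measurable lborel"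
      using borel_measurable_continuous_on_indicator[OF _ cont] by simp
    show "AE y in lborel. indicator {a..b} y *\<^sub>R (sin ((\<mu> - y) * t) / (\<mu> - y) * \<phi> y) =
        indicator {a..b} y *\<^sub>R (\<phi> y * dirichlet_kernel t (y - \<mu>))"
      using AE_lborel_singleton[of \<mu>] by eventually_elim (use eq in simp)
  qed
  then show ?thesis by (simp add: dirichlet_integral_def)
qed

lemma dirichlet_integral_eq:
  assumes "continuous_on {a..b} \<phi>"
  shows "dirichlet_integral \<phi> a b t \<mu> = 1 / pi * integral {a..b} (\<lambda>y. \<phi> y * dirichlet_kernel t (y - \<mu>))"
proof -
  have "(LINT y:{a..b}|lborel. \<phi> y * dirichlet_kernel t (y - \<mu>)) =
        integral {a..b} (\<lambda>y. \<phi> y * dirichlet_kernel t (y - \<mu>))"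
    by (intro set_borel_integral_eq_integral borel_integrable_atLeastAtMost' continuous_intros assms)
  then show ?thesis by (simp add: dirichlet_integral_eq_LINT[OF assms])
qed

lemma K1_expectation:
  assumes F: "type_I_family U F" "\<mu> \<in> U" and "a \<le> b" and \<phi>: "continuous_on {a..b} \<phi>"
  shows "integrable (interval_measure (F \<mu>)) (K1 F \<phi> a b t)"
    and "psi1 F \<phi> a b t \<mu> = dirichlet_integral \<phi> a b t \<mu>"
proof -
  note facts = type_I_family_facts[OF F]
  let ?P = "interval_measure (F \<mu>)"
  let ?k = "deconvolution_kernel (modulus F 0) (\<lambda>_. 1) t"
  have one: "set_borel_measurable lborel {-1..1} (\<lambda>_ :: real. 1 :: real)" "\<bar>1 :: real\<bar> \<le> 1"
    by (auto simp: set_borel_measurable_def intro!: borel_measurable_indicator)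
  note k = facts(1,5,4) one
  have K1: "K1 F \<phi> a b t x = t / (2 * pi) * (LINT y:{a..b}|lborel. \<phi> y * ?k (x - y))" for x
    by (simp add: K1_def deconvolution_kernel_def)
  obtain B where B: "\<bar>?k z\<bar> \<le> B" for z using deconvolution_kernel_bounded[OF k, where t = t] by blast
  have "compact (\<phi> ` {a..b})" using \<phi> by (intro compact_continuous_image) auto
  then obtain C where C: "\<bar>\<phi> y\<bar> \<le> C" if "y \<in> {a..b}" for y
    using compact_imp_bounded bounded_iff by (metis imageI real_norm_def)
  have bound: "\<bar>\<phi> y * ?k (x - y)\<bar> \<le> C * B" if "y \<in> {a..b}" for x y
    unfolding abs_mult by (rule mult_mono') (use B C that in auto)
  have [measurable]: "(\<lambda>y. indicator {a..b} y * \<phi> y) \<in> borel_measurable borel"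
    using borel_measurable_continuous_on_indicator[OF _ \<phi>] by simp
  have [measurable]: "?k \<in> borel_measurable borel" by (rule deconvolution_kernel_measurable[OF k])
  have "(\<lambda>(x, y). indicator {a..b} y * (\<phi> y * ?k (x - y))) =
        (\<lambda>(x, y). (indicator {a..b} y * \<phi> y) * ?k (x - y))" by (auto simp: fun_eq_iff)
  also have "\<dots> \<in> borel_measurable (borel \<Otimes>\<^sub>M borel)" by measurable
  finally have meas: "(\<lambda>(x, y). indicator {a..b} y * (\<phi> y * ?k (x - y))) \<in> borel_measurable (borel \<Otimes>\<^sub>M borel)" .
  note Fubini = Fubini_bounded_interval[OF facts(1) \<open>a \<le> b\<close> meas bound]
  show "integrable ?P (K1 F \<phi> a b t)"
    unfolding K1[abs_def] by (intro integrable_mult_right Fubini)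
  have "psi1 F \<phi> a b t \<mu> = t / (2 * pi) * (LINT y:{a..b}|lborel. (LINT x|?P. \<phi> y * ?k (x - y)))"
    unfolding psi1_def K1 using Fubini(2) by simp
  also have "\<dots> = t / (2 * pi) * (LINT y:{a..b}|lborel. \<phi> y * (LINT s:{-1..1}|lborel. cos (t * s * (\<mu> - y))))"
    by (simp add: deconvolution_kernel_expectation[OF k facts(2)])
  also have "\<dots> = (LINT y:{a..b}|lborel. 1 / (2 * pi) * (\<phi> y * (t * (LINT s:{-1..1}|lborel. cos (t * s * (\<mu> - y))))))"
    unfolding set_integral_mult_right[symmetric] by (simp add: algebra_simps)
  also have "\<dots> = (LINT y:{a..b}|lborel. 1 / pi * (\<phi> y * dirichlet_kernel t (y - \<mu>)))"
    unfolding LINT_cos_dirichlet_kernel using dirichlet_kernel_minus[of t "_ - \<mu>"] by simp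
  also have "\<dots> = dirichlet_integral \<phi> a b t \<mu>"
    unfolding set_integral_mult_right dirichlet_integral_eq_LINT[OF \<phi>] ..
  finally show "psi1 F \<phi> a b t \<mu> = dirichlet_integral \<phi> a b t \<mu>" .
qed

lemma K10_eq:
  assumes "type_I_family U F" "\<mu>' \<in> U"
  shows "K10 F \<omega> \<mu>' t x = deconvolution_kernel (modulus F 0) \<omega> t (x - \<mu>')"
  by (simp add: K10_def deconvolution_kernel_def type_I_family_facts(3)[OF assms])

lemma admissible_density_bounded:
  assumes "admissible_density \<omega>"
  obtains C where "\<And>s. s \<in> {-1..1} \<Longrightarrow> \<bar>\<omega> s\<bar> \<le> C"
proof -
  from assms have "bounded (\<omega> ` {-1..1})" by (simp add: admissible_density_def)
  then obtain C where "\<forall>x\<in>\<omega> ` {-1..1}. norm x \<le> C" unfolding bounded_iff by blast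
  then show thesis by (intro that[of C]) auto
qed

lemma K10_expectation:
  assumes F: "type_I_family U F" "\<mu> \<in> U" "\<mu>' \<in> U" and \<omega>: "admissible_density \<omega>"
  shows "integrable (interval_measure (F \<mu>)) (K10 F \<omega> \<mu>' t)"
    and "psi10 F \<omega> \<mu>' t \<mu> = (LINT s:{-1..1}|lborel. \<omega> s * cos (t * s * (\<mu> - \<mu>')))"
proof -
  note facts = type_I_family_facts[OF F(1,2)]
  obtain C where C: "\<And>s. s \<in> {-1..1} \<Longrightarrow> \<bar>\<omega> s\<bar> \<le> C"
    using admissible_density_bounded[OF \<omega>] by blast
  have m: "set_borel_measurable lborel {-1..1} \<omega>" using \<omega> by (simp add: admissible_density_def)
  note k = facts(1,5,4) m C
  show "integrable (interval_measure (F \<mu>)) (K10 F \<omega> \<mu>' t)"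
    unfolding K10_eq[OF F(1,3), abs_def] by (rule deconvolution_kernel_integrable[OF k])
  show "psi10 F \<omega> \<mu>' t \<mu> = (LINT s:{-1..1}|lborel. \<omega> s * cos (t * s * (\<mu> - \<mu>')))"
    unfolding psi10_def K10_eq[OF F(1,3)] by (rule deconvolution_kernel_expectation[OF k facts(2)])
qed

lemma psi10_tendsto:
  assumes F: "type_I_family U F" "\<mu> \<in> U" "\<mu>' \<in> U" and \<omega>: "admissible_density \<omega>"
  shows "((\<lambda>t. psi10 F \<omega> \<mu>' t \<mu>) \<longlongrightarrow> (if \<mu> = \<mu>' then 1 else 0)) at_top"
proof (cases "\<mu> = \<mu>'")
  case True
  have "psi10 F \<omega> \<mu>' t \<mu> = 1" for t
    using K10_expectation(2)[OF assms, of t] \<omega> True by (simp add: admissible_density_def)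
  then show ?thesis using True by simp
next
  case False
  obtain C where C: "\<And>s. s \<in> {-1..1} \<Longrightarrow> \<bar>\<omega> s\<bar> \<le> C"
    using admissible_density_bounded[OF \<omega>] by blast
  have [measurable]: "(\<lambda>s. indicator {-1..1} s * \<omega> s) \<in> borel_measurable borel"
    using \<omega> by (simp add: admissible_density_def set_borel_measurable_def)
  have "psi10 F \<omega> \<mu>' t \<mu> = integral {-1..1} (\<lambda>s. \<omega> s * cos (t * s * \<bar>\<mu> - \<mu>'\<bar>))" for t
  proof -
    have int: "set_integrable lborel {-1..1} (\<lambda>s. \<omega> s * cos (t * s * (\<mu> - \<mu>')))"
      unfolding set_integrable_def
    proof (rule Bochner_Integration.integrable_bound)
      show "integrable lborel (\<lambda>s. indicator {-1..1::real} s * C)"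
        by (intro integrable_mult_left integrable_real_indicator) auto
      have "(\<lambda>s. indicator {-1..1} s *\<^sub>R (\<omega> s * cos (t * s * (\<mu> - \<mu>')))) =
            (\<lambda>s. (indicator {-1..1} s * \<omega> s) * cos (t * s * (\<mu> - \<mu>')))" by (auto simp: fun_eq_iff)
      also have "\<dots> \<in> borel_measurable lborel" by measurable
      finally show "(\<lambda>s. indicator {-1..1} s *\<^sub>R (\<omega> s * cos (t * s * (\<mu> - \<mu>')))) \<in> borel_measurable lborel" .
      have "\<bar>\<omega> s * cos (t * s * (\<mu> - \<mu>'))\<bar> \<le> \<bar>C\<bar> * 1" if "s \<in> {-1..1}" for s
        unfolding abs_mult using C[OF that] by (intro mult_mono) auto
      then show "AE s in lborel. norm (indicator {-1..1} s *\<^sub>R (\<omega> s * cos (t * s * (\<mu> - \<mu>')))) \<le> norm (indicator {-1..1} s * C)"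
        by (auto simp: indicator_def)
    qed
    have "psi10 F \<omega> \<mu>' t \<mu> = integral {-1..1} (\<lambda>s. \<omega> s * cos (t * s * (\<mu> - \<mu>')))"
      unfolding K10_expectation(2)[OF assms] by (rule set_borel_integral_eq_integral[OF int])
    \<comment> \<open>The Riemann-Lebesgue lemma is stated for a positive frequency, hence the absolute value.\<close>
    moreover have "cos (t * s * (\<mu> - \<mu>')) = cos (t * s * \<bar>\<mu> - \<mu>'\<bar>)" for s
      using cos_minus[of "t * s * (\<mu> - \<mu>')"] by (simp add: abs_if algebra_simps)
    ultimately show ?thesis by (simp only:)
  qed
  then show ?thesis
    using riemann_lebesgue_bounded_variation[of \<omega> "-1" 1 "\<bar>\<mu> - \<mu>'\<bar>"] \<omega> False
    by (simp add: admissible_density_def)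
qed

theorem theorem6:
  fixes U :: "real set" and F :: "real \<Rightarrow> real \<Rightarrow> real"
    and \<phi> \<omega> :: "real \<Rightarrow> real" and a b :: real
  assumes "is_interval U" and "a < b" and "{a..b} \<subseteq> U"
    and "continuous_on {a..b} \<phi>" and "bounded_variation_on \<phi> a b"
    and "type_I_family U F"
    and "admissible_density \<omega>"
  shows "(\<forall>\<mu>\<in>U. \<forall>t. integrable (interval_measure (F \<mu>)) (K1 F \<phi> a b t) \<and>
            psi1 F \<phi> a b t \<mu> = dirichlet_integral \<phi> a b t \<mu>) \<and>
         (\<forall>\<mu>\<in>U. (\<forall>t. integrable (interval_measure (F \<mu>)) (kernel_K F \<omega> \<phi> a b t) \<and>
              psi F \<omega> \<phi> a b t \<mu> = (LINT x|interval_measure (F \<mu>). kernel_K F \<omega> \<phi> a b t x)) \<and>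
            ((\<lambda>t. psi F \<omega> \<phi> a b t \<mu>) \<longlongrightarrow> indicator {a<..<b} \<mu> * \<phi> \<mu>) at_top)"
proof (intro conjI ballI allI)
  fix \<mu> t assume \<mu>: "\<mu> \<in> U"
  have ab: "a \<in> U" "b \<in> U" using assms(2,3) by auto
  note K1 = K1_expectation[OF assms(6) \<mu> less_imp_le[OF assms(2)] assms(4)]
  note K10 = K10_expectation[OF assms(6) \<mu> _ assms(7)]
  show "integrable (interval_measure (F \<mu>)) (K1 F \<phi> a b t)"
    and "psi1 F \<phi> a b t \<mu> = dirichlet_integral \<phi> a b t \<mu>"
    by (rule K1)+
  show "integrable (interval_measure (F \<mu>)) (kernel_K F \<omega> \<phi> a b t)"
    unfolding kernel_K_def[abs_def] using K1 K10 ab by simp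
  show "psi F \<omega> \<phi> a b t \<mu> = (LINT x|interval_measure (F \<mu>). kernel_K F \<omega> \<phi> a b t x)"
    unfolding kernel_K_def psi_def psi1_def psi10_def using K1(1) K10(1) ab by simp
next
  fix \<mu> assume \<mu>: "\<mu> \<in> U"
  have ab: "a \<in> U" "b \<in> U" using assms(2,3) by auto
  have "psi1 F \<phi> a b t \<mu> = 1 / pi * integral {a..b} (\<lambda>y. \<phi> y * dirichlet_kernel t (y - \<mu>))" for t
    using assms \<mu> by (simp add: K1_expectation dirichlet_integral_eq)
  then have psi1: "((\<lambda>t. psi1 F \<phi> a b t \<mu>) \<longlongrightarrow>
      1 / pi * (pi / 2 * ((indicator {a..<b} \<mu> + indicator {a<..b} \<mu>) * \<phi> \<mu>))) at_top"
    using tendsto_mult_left[OF dirichlet_jordan[OF assms(2,4,5), of \<mu>], of "1 / pi"] by simp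
  note psi10 = psi10_tendsto[OF assms(6) \<mu> _ assms(7)]
  have "((\<lambda>t. psi F \<omega> \<phi> a b t \<mu>) \<longlongrightarrow>
      1 / pi * (pi / 2 * ((indicator {a..<b} \<mu> + indicator {a<..b} \<mu>) * \<phi> \<mu>)) -
      1 / 2 * (\<phi> a * (if \<mu> = a then 1 else 0) + \<phi> b * (if \<mu> = b then 1 else 0))) at_top"
    unfolding psi_def by (intro tendsto_intros psi1 psi10 ab)
  \<comment> \<open>At an end point the half value of the Dirichlet limit cancels against its correction term;
    \<open>a < b\<close> ensures that only one of the two corrections is active.\<close>
  moreover consider "\<mu> < a \<or> b < \<mu>" | "\<mu> = a" | "\<mu> = b" | "a < \<mu>" "\<mu> < b" by linarith
  then have "1 / pi * (pi / 2 * ((indicator {a..<b} \<mu> + indicator {a<..b} \<mu>) * \<phi> \<mu>)) -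
      1 / 2 * (\<phi> a * (if \<mu> = a then 1 else 0) + \<phi> b * (if \<mu> = b then 1 else 0)) =
      indicator {a<..<b} \<mu> * \<phi> \<mu>"
    by cases (use assms(2) in auto)
  ultimately show "((\<lambda>t. psi F \<omega> \<phi> a b t \<mu>) \<longlongrightarrow> indicator {a<..<b} \<mu> * \<phi> \<mu>) at_top"
    by (simp only:)
qed

end
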